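(* Let $q>8/15$. The inequality $$\frac{\sinh x}{x}>\left(\frac{8}{15q}+\left(1-\frac{8}{15q}\right)\cosh^q x\right)^{5/(15q-8)}$$ holds for all $x\in(0,\infty)$ if and only if $q\ge 34/35$. The reverse inequality (with $<$ in place of $>$) holds for all $x\in(0,\infty)$ if and only if $q\le 4/5$. *)

theory Defs
  imports Complex_Main
begin

end

theory Submission
  imports Defs "HOL-Real_Asymp.Real_Asymp"
begin

text \<open>
  Put \<open>r = 3 q - 8 / 5\<close> and \<open>S x = sinh x / x\<close>. The inequality compares \<open>(S x powr r - 1) / r\<close> with
  \<open>(cosh x powr q - 1) / (3 q)\<close>; both vanish at \<open>0\<close>, so it suffices to compare their derivatives. The
  logarithm of the quotient of these derivatives is affine in \<open>q\<close>, and it is positive for \<open>q = 34 / 35\<close>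
  and negative for \<open>q = 4 / 5\<close>: the numerators of its derivative in \<open>x\<close> are even power series whose
  coefficients are all nonnegative. In particular the slope in \<open>q\<close> is positive (Lazarevic's
  inequality \<open>cosh x < S x ^ 3\<close>), which settles all other values of \<open>q\<close>. Sharpness of \<open>34 / 35\<close> is
  seen as \<open>x\<close> tends to \<open>0\<close>, that of \<open>4 / 5\<close> as \<open>x\<close> tends to infinity.
\<close>

section \<open>Positivity from a positive derivative\<close>

text \<open>The limit at 0 only yields \<open>0 \<le> f (x / 2)\<close>; strict growth from
  \<open>x / 2\<close> to \<open>x\<close> restores strictness. A limit replaces a value at 0 since
  \<open>sinh x / x\<close> is singular there, and the bound \<open>b\<close> allows use on a short
  interval near 0.\<close>

lemma pos_of_deriv_pos:
  fixes f f' :: "real \<Rightarrow> real"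
  assumes "\<And>x. 0 < x \<Longrightarrow> x < b \<Longrightarrow> (f has_real_derivative f' x) (at x)"
    and "\<And>x. 0 < x \<Longrightarrow> x < b \<Longrightarrow> f' x > 0"
    and "(f \<longlongrightarrow> 0) (at_right 0)"
    and "0 < x" "x < b"
  shows "f x > 0"
proof -
  have mono: "f y < f z" if "0 < y" "y < z" "z < b" for y z
    using that assms(1,2) by (intro DERIV_pos_imp_increasing[OF that(2)]) force
  have "eventually (\<lambda>y. f y \<le> f (x / 2)) (at_right 0)"
    unfolding eventually_at_right_field
    using mono assms(4,5) by (intro exI[of _ "x / 2"]) (auto intro: less_imp_le)
  from tendsto_upperbound[OF assms(3) this] have "0 \<le> f (x / 2)" by simp
  also have "\<dots> < f x" using mono assms(4,5) by simp
  finally show ?thesis .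
qed

lemma xcosh_gt_sinh: "x * cosh x - sinh x > 0" if "x > 0" for x :: real
proof (rule pos_of_deriv_pos[where f = "\<lambda>x. x * cosh x - sinh x" and f' = "\<lambda>x. x * sinh x" and b = "x + 1"])
  show "((\<lambda>x. x * cosh x - sinh x) has_real_derivative y * sinh y) (at y)" if "0 < y" "y < x + 1" for y :: real
    by (auto intro!: derivative_eq_intros)
  show "((\<lambda>x::real. x * cosh x - sinh x) \<longlongrightarrow> 0) (at_right 0)"
    by real_asymp
qed (use that in auto)

section \<open>Even power series of hyperbolic expressions\<close>

lemma sums_even_part:
  fixes f :: "nat \<Rightarrow> real"
  assumes "f sums s" "\<And>n. odd n \<Longrightarrow> f n = 0"
  shows "(\<lambda>m. f (2 * m)) sums s"
proof -
  have "f n = 0" if "n \<notin> range (\<lambda>m. 2 * m)" for n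
    using that assms(2)[of n] by (auto elim!: evenE)
  then show ?thesis
    using assms(1) by (subst sums_mono_reindex) (auto simp: strict_mono_def)
qed

definition even_term :: "real \<Rightarrow> nat \<Rightarrow> real" where
  "even_term x m = x ^ (2 * m) / fact (2 * m)"

lemma cosh_mult_sums:
  fixes k x :: real
  shows "(\<lambda>m. k\<^sup>2 ^ m * even_term x m) sums cosh (k * x)"
proof -
  have "(k * x) ^ (2 * m) = k\<^sup>2 ^ m * x ^ (2 * m)" for m
    by (simp add: power_mult_distrib power_mult)
  then show ?thesis
    using sums_even_part[OF cosh_converges[of "k * x"]]
    by (simp add: even_term_def divide_inverse mult.assoc mult.left_commute mult.commute[of "inverse _"])
qed

lemma mult_sinh_mult_sums:
  fixes k x :: real
  assumes "k \<noteq> 0"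
  shows "(\<lambda>m. 2 * m / k * k\<^sup>2 ^ m * even_term x m) sums (x * sinh (k * x))"
proof -
  \<comment> \<open>The factor \<open>x\<close> shifts the odd exponents up by one;
    \<open>of_nat n\<close> corrects the factorial and makes the added term at 0 vanish.\<close>
  define f where "f = (\<lambda>n. if even n then of_nat n / k * k ^ n * (x ^ n / fact n) else 0)"
  have "(\<lambda>n. x * (if even n then 0 else (k * x) ^ n /\<^sub>R fact n)) sums (x * sinh (k * x))"
    by (rule sums_mult) (rule sinh_converges)
  also have "(\<lambda>n. x * (if even n then 0 else (k * x) ^ n /\<^sub>R fact n)) = (\<lambda>n. f (Suc n))"
    using assms by (auto simp: f_def fun_eq_iff power_mult_distrib divide_simps; simp add: algebra_simps)
  finally have "f sums (x * sinh (k * x))"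
    by (subst (asm) sums_Suc_iff) (simp add: f_def)
  from sums_even_part[OF this] show ?thesis
    by (simp add: f_def even_term_def power_mult)
qed

lemma square_mult_cosh_mult_sums:
  fixes k x :: real
  assumes "k \<noteq> 0"
  shows "(\<lambda>m. 2 * real m * (2 * real m - 1) / k\<^sup>2 * k\<^sup>2 ^ m * even_term x m)
           sums (x\<^sup>2 * cosh (k * x))"
proof -
  define f where "f = (\<lambda>m. 2 * real m * (2 * real m - 1) / k\<^sup>2 * k\<^sup>2 ^ m * even_term x m)"
  have "(\<lambda>m. x\<^sup>2 * (k\<^sup>2 ^ m * even_term x m)) sums (x\<^sup>2 * cosh (k * x))"
    by (rule sums_mult) (rule cosh_mult_sums)
  also have "(\<lambda>m. x\<^sup>2 * (k\<^sup>2 ^ m * even_term x m)) = (\<lambda>m. f (Suc m))"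
    using assms by (auto simp: f_def even_term_def fun_eq_iff power2_eq_square divide_simps add_eq_0_iff; simp add: algebra_simps)
  finally show ?thesis
    by (subst (asm) sums_Suc_iff) (simp add: f_def)
qed

text \<open>Linearises the cubic terms, so that the numerators below become combinations of the
  series above.\<close>

lemma sinh_cosh_triple:
  "4 * sinh x ^ 3 = sinh (3 * x) - 3 * sinh x"
  "4 * (cosh x * sinh x ^ 2) = cosh (3 * x) - cosh x" for x :: real
proof -
  have "sinh (3 * x) = sinh (2 * x + x)" "cosh (3 * x) = cosh (2 * x + x)" by simp_all
  moreover have c: "cosh x ^ 2 = 1 + sinh x ^ 2" using hyperbolic_pythagoras[of x] by simp
  ultimately show "4 * sinh x ^ 3 = sinh (3 * x) - 3 * sinh x"
     "4 * (cosh x * sinh x ^ 2) = cosh (3 * x) - cosh x"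
    unfolding sinh_add cosh_add sinh_double cosh_double
    by algebra+
qed

lemma even_series_pos:
  fixes a :: "nat \<Rightarrow> real"
  assumes "(\<lambda>m. a m * even_term x m) sums s" "x > 0"
    and "\<And>m. a m \<ge> 0" "a k > 0"
  shows "s > 0"
  using assms suminf_pos2[of "\<lambda>m. a m * even_term x m" k] by (simp add: sums_iff even_term_def)

section \<open>Positivity of the numerators of the derivative of the log-quotient\<close>

lemma log_slope_numerator_pos_4_5:
  fixes x :: real
  assumes "x > 0"
  shows "6 * x\<^sup>2 * cosh x + 3 * x * sinh x + 4 * x * sinh x ^ 3 - 9 * (cosh x * sinh x ^ 2) > 0"
proof -
  define a where "a = (\<lambda>m::nat. 9 ^ m * (2 * m / 3 - 9 / 4) + 12 * real m * (2 * real m - 1) + 9 / 4 :: real)"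
  have "a m \<ge> 0" for m
  \<comment> \<open>The coefficients for \<open>m < 4\<close> all vanish, so the series starts at
    \<open>x ^ 8\<close>. From \<open>m = 4\<close> on, \<open>2 * m / 3 > 9 / 4\<close> and every
    summand is nonnegative.\<close>
  proof (cases "m < 4")
    case True
    then have "m = 0 \<or> m = 1 \<or> m = 2 \<or> m = 3" by auto
    then show ?thesis by (auto simp: a_def)
  next
    case False
    then show ?thesis by (auto simp: a_def intro!: add_nonneg_nonneg mult_nonneg_nonneg)
  qed
  moreover have "a 4 > 0" by (simp add: a_def)
  moreover have "(\<lambda>m. a m * even_term x m) sums
     (6 * (x\<^sup>2 * cosh (1 * x)) + x * sinh (3 * x) - 9 / 4 * (cosh (3 * x) - cosh (1 * x)))"
    by (rule sums_cong[THEN iffD1, OF _ sums_diff[OF sums_add[OF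
          sums_mult[OF square_mult_cosh_mult_sums] mult_sinh_mult_sums]
          sums_mult[OF sums_diff[OF cosh_mult_sums cosh_mult_sums]]]])
       (simp_all add: a_def field_simps)
  ultimately have "6 * (x\<^sup>2 * cosh (1 * x)) + x * sinh (3 * x) - 9 / 4 * (cosh (3 * x) - cosh (1 * x)) > 0"
    using assms even_series_pos by blast
  also have "6 * (x\<^sup>2 * cosh (1 * x)) + x * sinh (3 * x) - 9 / 4 * (cosh (3 * x) - cosh (1 * x)) =
     6 * x\<^sup>2 * cosh x + 3 * x * sinh x + x * (4 * sinh x ^ 3) - 9 / 4 * (4 * (cosh x * sinh x ^ 2))"
    unfolding sinh_cosh_triple by (simp add: algebra_simps)
  finally show ?thesis by simp
qed

lemma log_slope_numerator_pos_34_35: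
  fixes x :: real
  assumes "x > 0"
  shows "12 * x\<^sup>2 * (cosh x * sinh x ^ 2) - 24 * x\<^sup>2 * cosh x - 58 * x * sinh x ^ 3 - 57 * x * sinh x
            + 81 * (cosh x * sinh x ^ 2) > 0"
proof -
  define a where "a = (\<lambda>m::nat. 9 ^ m * (2 * real m * (2 * real m - 1) / 3 - 29 / 3 * m + 81 / 4)
                         - 54 * real m * (2 * real m - 1) - 27 * m - 81 / 4 :: real)"
  have "a m \<ge> 0" for m
  \<comment> \<open>The coefficients for \<open>m < 5\<close> all vanish; the vanishing of the one
    at \<open>m = 4\<close> is what singles out \<open>q = 34 / 35\<close>.\<close>
  proof (cases "m < 5")
    case True
    then have "m = 0 \<or> m = 1 \<or> m = 2 \<or> m = 3 \<or> m = 4" by auto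
    then show ?thesis by (auto simp: a_def)
  next
    case False
    \<comment> \<open>The subtracted terms are at most \<open>108 * m ^ 2 + 81 / 4\<close>. The
      right-hand side is four times that, to be paired with the lower bound \<open>1 / 4\<close> of
      the factor of \<open>9 ^ m\<close>.\<close>
    then have "9 ^ m \<ge> 432 * real m ^ 2 + 81"
      unfolding not_less
    proof (induction m rule: dec_induct)
      case (step n)
      have "real n * 1 \<le> real n * real n"
        using step.hyps by (intro mult_left_mono) auto
      with step.IH show ?case by (simp add: power2_eq_square algebra_simps)
    qed auto
    moreover have "2 * real m * (2 * real m - 1) / 3 - 29 / 3 * m + 81 / 4 \<ge> (1 / 4 :: real)"
    proof -
      \<comment> \<open>The factor of \<open>9 ^ m\<close> equals this product plus
        \<open>23 / 12\<close>.\<close>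
      have "0 \<le> (real m - 5) * (4 / 3 * real m - 11 / 3)"
        using False by (intro mult_nonneg_nonneg) auto
      then show ?thesis by (simp add: field_simps)
    qed
    then have "9 ^ m * (1 / 4) \<le> 9 ^ m * (2 * real m * (2 * real m - 1) / 3 - 29 / 3 * m + 81 / 4 :: real)"
      by (intro mult_left_mono) auto
    ultimately show ?thesis
      by (simp add: a_def power2_eq_square algebra_simps)
  qed
  moreover have "a 5 > 0" by (simp add: a_def)
  moreover have "(\<lambda>m. a m * even_term x m) sums
     (3 * (x\<^sup>2 * cosh (3 * x)) - 27 * (x\<^sup>2 * cosh (1 * x)) - 29 / 2 * (x * sinh (3 * x)) - 27 / 2 * (x * sinh (1 * x))
       + 81 / 4 * (cosh (3 * x) - cosh (1 * x)))" (is "_ sums ?s")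
    by (rule sums_cong[THEN iffD1, OF _ sums_add[OF sums_diff[OF sums_diff[OF sums_diff[OF
         sums_mult[OF square_mult_cosh_mult_sums] sums_mult[OF square_mult_cosh_mult_sums]]
         sums_mult[OF mult_sinh_mult_sums]] sums_mult[OF mult_sinh_mult_sums]]
       sums_mult[OF sums_diff[OF cosh_mult_sums cosh_mult_sums]]]])
       (simp_all add: a_def field_simps)
  ultimately have "?s > 0"
    using assms even_series_pos by blast
  also have "?s = 3 * x\<^sup>2 * (4 * (cosh x * sinh x ^ 2)) - 24 * x\<^sup>2 * cosh x - 29 / 2 * x * (4 * sinh x ^ 3)
     - 57 * x * sinh x + 81 / 4 * (4 * (cosh x * sinh x ^ 2))"
    unfolding sinh_cosh_triple by (simp add: algebra_simps)
  finally show ?thesis by simp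
qed

section \<open>The log-quotient of the derivatives: limits and sign\<close>

text \<open>
  The logarithm of the quotient of the derivatives of \<open>(S x powr r - 1) / r\<close> and
  \<open>(cosh x powr q - 1) / (3 q)\<close>, with the terms containing \<open>q\<close> collected.
\<close>
definition log_slope :: "real \<Rightarrow> real \<Rightarrow> real" where
  "log_slope q x = (q - 1) * (3 * ln (sinh x / x) - ln (cosh x)) + 2 / 5 * ln (sinh x / x)
     + ln (3 * (x * cosh x - sinh x) / (x\<^sup>2 * sinh x))"

lemma log_slope_affine: "log_slope q x = log_slope p x + (q - p) * (3 * ln (sinh x / x) - ln (cosh x))"
  by (simp add: log_slope_def field_simps)

text \<open>The quadratic terms cancel: \<open>ln (sinh x / x)\<close> starts with
  \<open>x^2 / 6 - x^4 / 180\<close> and \<open>ln (cosh x)\<close> with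
  \<open>x^2 / 2 - x^4 / 12\<close>.\<close>

lemma lazarevic_quotient_lim: "((\<lambda>x::real. (3 * ln (sinh x / x) - ln (cosh x)) / x ^ 4) \<longlongrightarrow> 1 / 15) (at_right 0)"
  by real_asymp

lemma log_slope_quotient_lim: "((\<lambda>x::real. log_slope (34 / 35) x / x ^ 4) \<longlongrightarrow> 0) (at_right 0)"
  unfolding log_slope_def by real_asymp

lemma log_slope_lim: "((\<lambda>x::real. log_slope q x) \<longlongrightarrow> 0) (at_right 0)"
  unfolding log_slope_def by real_asymp

text \<open>Up to a constant, the quotient behaves like \<open>x powr r * exp ((q - r) * x)\<close>.
  For \<open>r = 3 * q - 8 / 5\<close> the condition \<open>q < r\<close> reads
  \<open>q > 4 / 5\<close>.\<close>

lemma cosh_powr_over_sinhc_powr_lim: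
  fixes q r :: real
  assumes "0 < q" "q < r"
  shows "((\<lambda>x::real. cosh x powr q / (sinh x / x) powr r) \<longlongrightarrow> 0) at_top"
  using assms by real_asymp

lemma inverse_sinhc_powr_lim:
  fixes q r :: real
  assumes "0 < r"
  shows "((\<lambda>x::real. 1 / (sinh x / x) powr r) \<longlongrightarrow> 0) at_top"
  using assms by real_asymp

lemma log_derivs:
  fixes x :: real
  assumes "x > 0"
  shows "((\<lambda>x. ln (sinh x / x)) has_real_derivative (x * cosh x - sinh x) / (x * sinh x)) (at x)"
    and "((\<lambda>x::real. ln (cosh x)) has_real_derivative sinh x / cosh x) (at x)"
    and "((\<lambda>x. ln (3 * (x * cosh x - sinh x) / (x\<^sup>2 * sinh x))) has_real_derivative
        x * sinh x / (x * cosh x - sinh x) - 2 / x - cosh x / sinh x) (at x)"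
proof -
  have *: "x * cosh x - sinh x > 0" "sinh x > 0" "x \<noteq> 0" using assms xcosh_gt_sinh by auto
  show "((\<lambda>x. ln (sinh x / x)) has_real_derivative (x * cosh x - sinh x) / (x * sinh x)) (at x)"
    using * assms by (auto intro!: derivative_eq_intros simp: field_simps power2_eq_square)
  show "((\<lambda>x::real. ln (cosh x)) has_real_derivative sinh x / cosh x) (at x)"
    by (auto intro!: derivative_eq_intros)
  show "((\<lambda>x. ln (3 * (x * cosh x - sinh x) / (x\<^sup>2 * sinh x))) has_real_derivative
        x * sinh x / (x * cosh x - sinh x) - 2 / x - cosh x / sinh x) (at x)"
    using * assms
    by (auto intro!: derivative_eq_intros, simp add: divide_simps, simp add: algebra_simps power2_eq_square)
qed

definition log_slope' :: "real \<Rightarrow> real \<Rightarrow> real" where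
  "log_slope' q x = (q - 1) * (3 * ((x * cosh x - sinh x) / (x * sinh x)) - sinh x / cosh x)
     + 2 / 5 * ((x * cosh x - sinh x) / (x * sinh x))
     + (x * sinh x / (x * cosh x - sinh x) - 2 / x - cosh x / sinh x)"

lemma log_slope_deriv:
  assumes "x > 0"
  shows "(log_slope q has_real_derivative log_slope' q x) (at x)"
  unfolding log_slope_def log_slope'_def by (intro DERIV_add DERIV_cmult DERIV_diff log_derivs assms)

text \<open>Multiplying by a positive common denominator reduces the sign of
  \<open>log_slope'\<close> to that of a polynomial in \<open>x\<close>, \<open>sinh x\<close> and
  \<open>cosh x\<close>.\<close>

lemma log_slope'_mult_denominator:
  fixes x :: real
  defines "s \<equiv> sinh x" and "c \<equiv> cosh x"
  assumes "x > 0"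
  shows "log_slope' q x * (x * s * c * (x * c - s)) =
    (3 * q - 13 / 5) * (x * c - s)\<^sup>2 * c - (q - 1) * (x * c - s) * x * s\<^sup>2
    + (x\<^sup>2 * s\<^sup>2 * c - 2 * s * c * (x * c - s) - x * c\<^sup>2 * (x * c - s))"
proof -
  have "s > 0" "c > 0" "x * c - s > 0"
    using assms xcosh_gt_sinh by (auto simp: s_def c_def)
  then have "(x * c - s) / (x * s) * (x * s * c * (x * c - s)) = (x * c - s)\<^sup>2 * c"
    "s / c * (x * s * c * (x * c - s)) = (x * c - s) * x * s\<^sup>2"
    "(x * s / (x * c - s) - 2 / x - c / s) * (x * s * c * (x * c - s)) =
       x\<^sup>2 * s\<^sup>2 * c - 2 * s * c * (x * c - s) - x * c\<^sup>2 * (x * c - s)"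
    using assms(3) by (simp_all add: divide_simps) (simp_all add: algebra_simps power2_eq_square)
  then show ?thesis
    unfolding log_slope'_def s_def[symmetric] c_def[symmetric] by algebra
qed

lemma denominator_pos: "x * sinh x * cosh x * (x * cosh x - sinh x) > 0" if "x > 0" for x :: real
  using that xcosh_gt_sinh by simp

lemma log_slope_pos:
  assumes "x > 0"
  shows "log_slope (34 / 35) x > 0"
proof (rule pos_of_deriv_pos[where f = "log_slope (34 / 35)" and f' = "log_slope' (34 / 35)" and b = "x + 1"])
  fix y :: real assume y: "0 < y"
  then show "(log_slope (34 / 35) has_real_derivative log_slope' (34 / 35) y) (at y)" by (rule log_slope_deriv)
  have "35 * (log_slope' (34 / 35) y * (y * sinh y * cosh y * (y * cosh y - sinh y))) =
      12 * y\<^sup>2 * (cosh y * sinh y ^ 2) - 24 * y\<^sup>2 * cosh y - 58 * y * sinh y ^ 3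
        - 57 * y * sinh y + 81 * (cosh y * sinh y ^ 2)"
    unfolding log_slope'_mult_denominator[OF y] using cosh_square_eq[of y] by algebra
  with log_slope_numerator_pos_34_35[OF y] have "log_slope' (34 / 35) y * (y * sinh y * cosh y * (y * cosh y - sinh y)) > 0"
    by linarith
  then show "log_slope' (34 / 35) y > 0"
    using denominator_pos[OF y] by (simp only: zero_less_mult_pos2)
qed (use assms log_slope_lim in auto)

lemma log_slope_neg:
  assumes "x > 0"
  shows "log_slope (4 / 5) x < 0"
proof -
  have "- log_slope (4 / 5) x > 0"
  proof (rule pos_of_deriv_pos[where f = "\<lambda>x. - log_slope (4 / 5) x" and f' = "\<lambda>x. - log_slope' (4 / 5) x" and b = "x + 1"])
    fix y :: real assume y: "0 < y"
    then show "((\<lambda>x. - log_slope (4 / 5) x) has_real_derivative - log_slope' (4 / 5) y) (at y)"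
      by (intro DERIV_minus log_slope_deriv)
    have "- 5 * (log_slope' (4 / 5) y * (y * sinh y * cosh y * (y * cosh y - sinh y))) =
        6 * y\<^sup>2 * cosh y + 3 * y * sinh y + 4 * y * sinh y ^ 3 - 9 * (cosh y * sinh y ^ 2)"
      unfolding log_slope'_mult_denominator[OF y] using cosh_square_eq[of y] by algebra
    with log_slope_numerator_pos_4_5[OF y] have "- log_slope' (4 / 5) y * (y * sinh y * cosh y * (y * cosh y - sinh y)) > 0"
      by linarith
    then show "- log_slope' (4 / 5) y > 0"
      using denominator_pos[OF y] by (simp only: zero_less_mult_pos2)
  qed (use assms tendsto_minus[OF log_slope_lim] in auto)
  then show ?thesis by simp
qed

text \<open>By affinity in \<open>q\<close>,
  \<open>log_slope (34 / 35) x - log_slope (4 / 5) x\<close> is \<open>6 / 35\<close> times this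
  expression, and the two values have opposite signs.\<close>

lemma lazarevic:
  fixes x :: real
  assumes "x > 0"
  shows "3 * ln (sinh x / x) - ln (cosh x) > 0"
  using log_slope_pos[OF assms] log_slope_neg[OF assms] by (simp add: log_slope_affine[of "4 / 5" _ "34 / 35"])

section \<open>Reduction of the inequality to the sign of a difference\<close>

text \<open>The constants \<open>3\<close> and \<open>8 / 5\<close> make the expansions of both
  terms at 0 agree through \<open>x^4\<close>.\<close>

definition gap :: "real \<Rightarrow> real \<Rightarrow> real" where
  "gap q x = ((sinh x / x) powr (3 * q - 8 / 5) - 1) / (3 * q - 8 / 5) - (cosh x powr q - 1) / (3 * q)"

lemma gap_lim:
  assumes "q > 8 / 15"
  shows "(gap q \<longlongrightarrow> 0) (at_right 0)"
proof -
  have "((\<lambda>x::real. sinh x / x) \<longlongrightarrow> 1) (at_right 0)" "((\<lambda>x::real. cosh x) \<longlongrightarrow> 1) (at_right 0)"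
    by real_asymp+
  then have "(gap q \<longlongrightarrow> (1 powr (3 * q - 8 / 5) - 1) / (3 * q - 8 / 5) - (1 powr q - 1) / (3 * q)) (at_right 0)"
    unfolding gap_def using assms by (intro tendsto_intros) auto
  then show ?thesis by simp
qed

text \<open>Since \<open>exp (log_slope q x)\<close> is the quotient of the derivatives of the two
  terms, the derivative of the second factors out, and the sign is that of
  \<open>log_slope q x\<close>.\<close>

lemma gap_deriv:
  fixes x :: real
  assumes "x > 0" "q > 8 / 15"
  shows "(gap q has_real_derivative cosh x powr (q - 1) * sinh x / 3 * (exp (log_slope q x) - 1)) (at x)"
proof -
  have *: "x * cosh x - sinh x > 0" "sinh x > 0" "x \<noteq> 0" using assms xcosh_gt_sinh by auto
  have "exp (log_slope q x) = (sinh x / x) powr (3 * q - 8 / 5 - 1) / cosh x powr (q - 1)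
      * (3 * (x * cosh x - sinh x) / (x\<^sup>2 * sinh x))"
  proof -
    have "log_slope q x = (3 * q - 8 / 5 - 1) * ln (sinh x / x) - (q - 1) * ln (cosh x)
     + ln (3 * (x * cosh x - sinh x) / (x\<^sup>2 * sinh x))"
      by (simp add: log_slope_def field_simps)
    then show ?thesis using * assms by (simp add: exp_add exp_diff powr_def)
  qed
  then have "cosh x powr (q - 1) * sinh x / 3 * (exp (log_slope q x) - 1) =
      (sinh x / x) powr (3 * q - 8 / 5 - 1) * ((x * cosh x - sinh x) / x\<^sup>2) - cosh x powr (q - 1) * sinh x / 3"
    using * by (simp add: field_simps)
  moreover have "(gap q has_real_derivative
      ((3 * q - 8 / 5) * (sinh x / x) powr (3 * q - 8 / 5 - of_nat 1) * ((x * cosh x - sinh x) / x\<^sup>2) - 0) / (3 * q - 8 / 5)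
      - (q * cosh x powr (q - of_nat 1) * sinh x - 0) / (3 * q)) (at x)"
    unfolding gap_def
  proof (intro DERIV_diff DERIV_cdivide DERIV_fun_powr DERIV_const)
    show "((\<lambda>x. sinh x / x) has_real_derivative (x * cosh x - sinh x) / x\<^sup>2) (at x)"
      using assms by (auto intro!: derivative_eq_intros simp: field_simps power2_eq_square)
  qed (use * assms in \<open>auto intro!: derivative_eq_intros\<close>)
  ultimately show ?thesis using assms by (simp add: diff_divide_distrib)
qed

lemma gap_pos_on:
  assumes "q > 8 / 15" "0 < x" "x < b" "\<And>y. 0 < y \<Longrightarrow> y < b \<Longrightarrow> log_slope q y > 0"
  shows "gap q x > 0"
  using assms
  by (intro pos_of_deriv_pos[where f = "gap q" and b = b and
          f' = "\<lambda>x. cosh x powr (q - 1) * sinh x / 3 * (exp (log_slope q x) - 1)"] gap_deriv gap_lim) auto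

lemma gap_neg_on:
  assumes "q > 8 / 15" "0 < x" "x < b" "\<And>y. 0 < y \<Longrightarrow> y < b \<Longrightarrow> log_slope q y < 0"
  shows "gap q x < 0"
proof -
  have "- gap q x > 0"
    using assms tendsto_minus[OF gap_lim[of q]]
    by (intro pos_of_deriv_pos[where f = "\<lambda>x. - gap q x" and b = b and
          f' = "\<lambda>x. - (cosh x powr (q - 1) * sinh x / 3 * (exp (log_slope q x) - 1))"] DERIV_minus gap_deriv)
      (auto simp: mult_less_0_iff mult_pos_neg)
  then show ?thesis by simp
qed

text \<open>As \<open>5 / (15 * q - 8)\<close> is \<open>1 / r\<close> with
  \<open>r = 3 * q - 8 / 5 > 0\<close>, \<open>B powr r\<close> is the base of the power
  \<open>B\<close>, and \<open>gap q x\<close> is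
  \<open>((sinh x / x) powr r - B powr r) / r\<close>. Monotonicity of \<open>powr r\<close>
  compares the bases.\<close>

lemma gap_iff:
  assumes "q > 8 / 15" "x > 0"
  defines "B \<equiv> (8 / (15 * q) + (1 - 8 / (15 * q)) * cosh x powr q) powr (5 / (15 * q - 8))"
  shows "sinh x / x > B \<longleftrightarrow> gap q x > 0" "sinh x / x < B \<longleftrightarrow> gap q x < 0"
proof -
  define r where "r = 3 * q - 8 / 5"
  define D where "D = 8 / (15 * q) + (1 - 8 / (15 * q)) * cosh x powr q"
  have r: "r > 0" "5 / (15 * q - 8) = 1 / r" using assms(1) by (auto simp: r_def field_simps)
  have D: "D > 0" using assms(1) by (auto simp: D_def intro!: add_pos_nonneg)
  have S: "sinh x / x > 0" using assms by simp
  have "gap q x = ((sinh x / x) powr r - D) / r"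
    using assms(1) r(1) unfolding gap_def r_def[symmetric]
    by (simp add: D_def r_def divide_simps) (simp add: algebra_simps)
  moreover have "D = B powr r"
    using r D by (simp add: B_def D_def[symmetric] powr_powr)
  ultimately have *: "gap q x = ((sinh x / x) powr r - B powr r) / r" by simp
  have "B > 0" using D by (simp add: B_def D_def[symmetric])
  have less: "u powr r < v powr r \<longleftrightarrow> u < v" if "u > 0" "v > 0" for u v
    using that r(1) by (meson powr_less_cancel2 powr_less_mono2 less_imp_le)
  show "sinh x / x > B \<longleftrightarrow> gap q x > 0" "sinh x / x < B \<longleftrightarrow> gap q x < 0"
    using r(1) S \<open>B > 0\<close> less[of B "sinh x / x"] less[of "sinh x / x" B]
    unfolding * by (simp_all add: zero_less_divide_iff divide_less_0_iff)
qed

section \<open>Sharpness of the two constants\<close>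

text \<open>Near 0, \<open>log_slope q x\<close> behaves like
  \<open>(q - 34 / 35) / 15 * x ^ 4\<close>, so it is negative on some interval starting at 0, and
  hence so is \<open>gap q\<close>.\<close>

lemma ex_gap_neg:
  assumes "q > 8 / 15" "q < 34 / 35"
  shows "\<exists>x>0. gap q x < 0"
proof -
  have "((\<lambda>x. log_slope (34 / 35) x / x ^ 4
      + (q - 34 / 35) * ((3 * ln (sinh x / x) - ln (cosh x)) / x ^ 4))
      \<longlongrightarrow> 0 + (q - 34 / 35) * (1 / 15)) (at_right 0)"
    by (intro tendsto_intros log_slope_quotient_lim lazarevic_quotient_lim)
  then have "((\<lambda>x. log_slope q x / x ^ 4) \<longlongrightarrow> (q - 34 / 35) / 15) (at_right 0)"
    by (subst log_slope_affine[of _ _ "34 / 35"]) (simp add: add_divide_distrib)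
  then have "eventually (\<lambda>x. log_slope q x / x ^ 4 < 0) (at_right 0)"
    using assms by (intro order_tendstoD) auto
  then obtain b where "b > 0" and b: "\<And>y. 0 < y \<Longrightarrow> y < b \<Longrightarrow> log_slope q y < 0"
    unfolding eventually_at_right_field by (auto simp: divide_less_0_iff)
  then have "gap q (b / 2) < 0" using assms by (intro gap_neg_on[where b = b]) auto
  then show ?thesis using \<open>b > 0\<close> by (intro exI[of _ "b / 2"]) auto
qed

lemma ex_gap_pos:
  assumes "q > 4 / 5"
  shows "\<exists>x>0. gap q x > 0"
proof -
  define r where "r = 3 * q - 8 / 5"
  have r: "r > 0" "r > q" "q > 0" using assms by (auto simp: r_def)
  \<comment> \<open>This is \<open>gap q x\<close> divided by \<open>(sinh x / x) powr r\<close>,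
    which dominates \<open>cosh x powr q\<close> at infinity because \<open>r > q\<close>; only
    \<open>1 / r\<close> survives.\<close>
  have "((\<lambda>x::real. (1 - 1 / (sinh x / x) powr r) / r
      - (cosh x powr q / (sinh x / x) powr r - 1 / (sinh x / x) powr r) / (3 * q))
      \<longlongrightarrow> (1 - 0) / r - (0 - 0) / (3 * q)) at_top"
    using r by (intro tendsto_intros cosh_powr_over_sinhc_powr_lim inverse_sinhc_powr_lim) auto
  moreover have "eventually (\<lambda>x::real. (1 - 1 / (sinh x / x) powr r) / r
      - (cosh x powr q / (sinh x / x) powr r - 1 / (sinh x / x) powr r) / (3 * q) = gap q x / (sinh x / x) powr r) at_top"
    using eventually_gt_at_top[of 0]
  proof eventually_elim
    case (elim x)
    then have "(sinh x / x) powr r \<noteq> 0" by simp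
    then show ?case
      unfolding gap_def r_def[symmetric] by (simp add: diff_divide_distrib mult.commute del: powr_eq_0_iff)
  qed
  ultimately have "((\<lambda>x. gap q x / (sinh x / x) powr r) \<longlongrightarrow> (1 - 0) / r - (0 - 0) / (3 * q)) at_top"
    by (rule Lim_transform_eventually)
  then have "((\<lambda>x. gap q x / (sinh x / x) powr r) \<longlongrightarrow> 1 / r) at_top"
    by simp
  then have "eventually (\<lambda>x. gap q x / (sinh x / x) powr r > 0) at_top"
    by (rule order_tendstoD(1)) (use r in simp)
  then have "eventually (\<lambda>x. x > 0 \<and> gap q x > 0) at_top"
    using eventually_gt_at_top[of 0] by eventually_elim (auto simp: zero_less_divide_iff)
  then show ?thesis
    by (metis (mono_tags, lifting) eventually_happens' trivial_limit_at_top_linorder)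
qed

theorem theorem5:
  fixes q :: real
  assumes "q > 8 / 15"
  shows "((\<forall>x\<in>{0<..}. sinh x / x >
             (8 / (15 * q) + (1 - 8 / (15 * q)) * cosh x powr q) powr (5 / (15 * q - 8)))
           \<longleftrightarrow> q \<ge> 34 / 35) \<and>
         ((\<forall>x\<in>{0<..}. sinh x / x <
             (8 / (15 * q) + (1 - 8 / (15 * q)) * cosh x powr q) powr (5 / (15 * q - 8)))
           \<longleftrightarrow> q \<le> 4 / 5)"
proof -
  have "gap q x > 0" if "q \<ge> 34 / 35" "x > 0" for x
  proof (rule gap_pos_on[OF assms, where b = "x + 1"])
    fix y :: real assume "y > 0"
    then show "log_slope q y > 0"
      using log_slope_pos[of y] lazarevic[of y] that
      by (subst log_slope_affine[of _ _ "34 / 35"]) (auto intro!: add_pos_nonneg)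
  qed (use that in auto)
  moreover have "gap q x < 0" if "q \<le> 4 / 5" "x > 0" for x
  proof (rule gap_neg_on[OF assms, where b = "x + 1"])
    fix y :: real assume "y > 0"
    then have "(4 / 5 - q) * (3 * ln (sinh y / y) - ln (cosh y)) \<ge> 0"
      using lazarevic[of y] that by simp
    then show "log_slope q y < 0"
      using log_slope_neg[OF \<open>y > 0\<close>] by (subst log_slope_affine[of _ _ "4 / 5"]) (simp add: algebra_simps)
  qed (use that in auto)
  \<comment> \<open>The two sign results give sufficiency; necessity follows by contraposition from
    the points where \<open>gap q\<close> has the wrong sign.\<close>
  ultimately show ?thesis
    using gap_iff[OF assms] ex_gap_neg[OF assms] ex_gap_pos[of q]
    by (force simp: not_le[symmetric] simp del: not_le)
qed

end
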